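(* Suppose that $\varrho$ is an irreducible substitution on a compact Hausdorff alphabet $\mathcal{A}$ and that its subshift $X$ is uniquely ergodic. Let $r$ be the spectral radius of the substitution operator of $\varrho$. Then, for all $0<\epsilon<r$, there exists some $N=N(\epsilon)$ such that, for all $a\in\mathcal{A}$ and $n\ge N$, $$(r-\epsilon)^n\le\#\varrho^n(a)\le(r+\epsilon)^n.$$
   Context: Alphabet and words: $\mathcal{A}$ is a non-empty compact Hausdorff space; $\mathcal{A}^\ast = \bigsqcup_{i\ge 0}\mathcal{A}^i$ is the space of finite words (product topologies, disjoint union topology). $\#u$ is the length of a word $u$; $v\triangleleft u$ means that $v$ is a (contiguous) subword of the finite or bi-infinite word $u$. Substitutions: a substitution is a continuous map $\varrho\colon\mathcal{A}\to\mathcal{A}^\ast$, extended to $\mathcal{A}^\ast$ by concatenation. Standing assumption: $\varrho$ generates arbitrarily long words, i.e. for every $k\in\mathbb{N}$ there are $n\in\mathbb{N}$ and $a\in\mathcal{A}$ with $\#\varrho^n(a)\ge k$. $\varrho$ is irreducible if there is no non-empty closed proper subset $\mathcal{B}\subsetneq\mathcal{A}$ with $\varrho(\mathcal{B})\subset\mathcal{B}^\ast$. The substitution operator $M$ on $C(\mathcal{A})$ (real continuous functions, sup norm) is $(Mf)(a)=\sum_{b\triangleleft\varrho(a)}f(b)$ (sum over letters of $\varrho(a)$ with multiplicity). Subshift: $\mathcal{L}(\varrho)$ is the closure in $\mathcal{A}^\ast$ of the set of words $u$ with $u\triangleleft\varrho^n(a)$ for some $n\in\mathbb{N}_0$, $a\in\mathcal{A}$.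 $X=\{w\in\mathcal{A}^{\mathbb{Z}} : \text{every finite } u\triangleleft w \text{ lies in } \mathcal{L}(\varrho)\}$ (subspace of the product topology), with left shift $\sigma$. A measure on $X$ is a positive continuous linear functional $\mu$ on $C(X)$; it is a probability measure if $\mu(\mathbf{1})=1$ and $\sigma$-invariant if $\mu(f\circ\sigma)=\mu(f)$ for all $f\in C(X)$. $X$ is uniquely ergodic if it has exactly one $\sigma$-invariant probability measure. *)

theory Defs
  imports "HOL-Analysis.Analysis" "HOL-Library.Sublist"
begin

section \<open>Words and substitutions\<close>

text \<open>
  The alphabet is the type \<open>'a\<close>. Finite words are lists; their topology is transported along the
  bijection with the disjoint union over \<open>n\<close> of the products of \<open>n\<close> copies of \<open>'a\<close>.
\<close>

definition word_topology :: "'a::topological_space list topology" where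
  "word_topology =
     pullback_topology UNIV (\<lambda>u. (length u, \<lambda>i\<in>{..<length u}. u ! i))
       (sum_topology (\<lambda>n. product_topology (\<lambda>_. euclidean) {..<n}) UNIV)"

definition substitution :: "('a::topological_space \<Rightarrow> 'a list) \<Rightarrow> bool" where
  "substitution \<rho> \<longleftrightarrow> continuous_map euclidean word_topology \<rho>"

definition subst_word :: "('a \<Rightarrow> 'a list) \<Rightarrow> 'a list \<Rightarrow> 'a list" where
  "subst_word \<rho> u = concat (map \<rho> u)"

definition subst_iter :: "('a \<Rightarrow> 'a list) \<Rightarrow> nat \<Rightarrow> 'a \<Rightarrow> 'a list" where
  "subst_iter \<rho> n a = (subst_word \<rho> ^^ n) [a]"

definition generates_long_words :: "('a \<Rightarrow> 'a list) \<Rightarrow> bool" where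
  "generates_long_words \<rho> \<longleftrightarrow> (\<forall>k. \<exists>n a. k \<le> length (subst_iter \<rho> n a))"

definition irreducible_subst :: "('a::topological_space \<Rightarrow> 'a list) \<Rightarrow> bool" where
  "irreducible_subst \<rho> \<longleftrightarrow>
     \<not> (\<exists>B. B \<noteq> {} \<and> closed B \<and> B \<subset> UNIV \<and> \<rho> ` B \<subseteq> lists B)"

section \<open>The substitution operator and its spectral radius\<close>

text \<open>
  For a substitution, the argument of \<open>Bcontfun\<close> is continuous, and it is bounded when the alphabet
  is compact; see \<open>apply_subst_operator\<close> below.
\<close>

definition subst_operator ::
    "('a::topological_space \<Rightarrow> 'a list) \<Rightarrow> ('a \<Rightarrow>\<^sub>C real) \<Rightarrow> ('a \<Rightarrow>\<^sub>C real)" where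
  "subst_operator \<rho> f = Bcontfun (\<lambda>a. \<Sum>b\<leftarrow>\<rho> a. apply_bcontfun f b)"

lemma continuous_map_sum_list_word:
  fixes f :: "'a::topological_space \<Rightarrow> real"
  assumes "continuous_on UNIV f"
  shows "continuous_map word_topology euclidean (\<lambda>u. \<Sum>b\<leftarrow>u. f b)"
proof -
  let ?P = "\<lambda>n::nat. product_topology (\<lambda>_. euclidean :: 'a topology) {..<n}"
  let ?g = "\<lambda>(n::nat, x). \<Sum>i<n. f (x i)"
  have "continuous_map (?P n) euclidean (\<lambda>x. \<Sum>i<n. f (x i))" for n :: nat
  proof (intro continuous_map_sum)
    fix i assume "i \<in> {..<n}"
    then have "continuous_map (?P n) euclidean (\<lambda>x. x i)"
      by (rule continuous_map_product_projection)
    then show "continuous_map (?P n) euclidean (\<lambda>x. f (x i))"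
      using assms continuous_map_compose [of "?P n" euclidean "\<lambda>x. x i" euclidean f]
      by (simp add: o_def)
  qed auto
  then have P: "openin (?P n) {x \<in> topspace (?P n). (\<Sum>i<n. f (x i)) \<in> U}" if "open U" for U and n :: nat
    using that by (simp add: continuous_map)
  have "continuous_map (sum_topology ?P UNIV) euclidean ?g"
    unfolding continuous_map openin_sum_topology
  proof (intro conjI allI impI ballI)
    fix U :: "real set" and n :: nat
    assume "openin euclidean U"
    then show "openin (?P n) {x. (n, x) \<in> {p \<in> topspace (sum_topology ?P UNIV). ?g p \<in> U}}"
      using P [of U n] by simp
  qed auto
  then have "continuous_map word_topology euclidean
      (?g \<circ> (\<lambda>u. (length u, \<lambda>i\<in>{..<length u}. u ! i)))"
    unfolding word_topology_def by (rule continuous_map_pullback)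
  moreover have "?g \<circ> (\<lambda>u. (length u, \<lambda>i\<in>{..<length u}. u ! i)) = (\<lambda>u. \<Sum>b\<leftarrow>u. f b)"
    by (auto simp: fun_eq_iff sum_list_sum_nth atLeast0LessThan)
  ultimately show ?thesis by simp
qed

lemma apply_subst_operator:
  fixes \<rho> :: "'a::topological_space \<Rightarrow> 'a list"
  assumes "compact (UNIV :: 'a set)" "substitution \<rho>"
  shows "apply_bcontfun (subst_operator \<rho> f) a = (\<Sum>b\<leftarrow>\<rho> a. apply_bcontfun f b)"
proof -
  have "continuous_map word_topology euclidean (\<lambda>u. \<Sum>b\<leftarrow>u. apply_bcontfun f b)"
    by (rule continuous_map_sum_list_word) simp
  from continuous_map_compose [OF assms(2)[unfolded substitution_def] this]
  have c: "continuous_on UNIV (\<lambda>a. \<Sum>b\<leftarrow>\<rho> a. apply_bcontfun f b)"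
    by (simp add: o_def)
  then have "bounded (range (\<lambda>a. \<Sum>b\<leftarrow>\<rho> a. apply_bcontfun f b))"
    using assms(1) compact_continuous_image compact_imp_bounded by blast
  with c show ?thesis
    by (simp add: subst_operator_def Bcontfun_inverse bcontfun_def)
qed

text \<open>
  The spectrum of an operator on a real Banach space is that of its complexification, modelled on
  pairs \<open>(x, y)\<close> standing for \<open>x + \<i> y\<close>. The product norm is equivalent to any of the usual norms
  on the complexification, and a real-linear inverse of a complex-linear map is complex-linear.
\<close>

definition complexify :: "('e \<Rightarrow> 'e) \<Rightarrow> 'e \<times> 'e \<Rightarrow> 'e \<times> 'e" where
  "complexify T = (\<lambda>(x, y). (T x, T y))"

definition cscale :: "complex \<Rightarrow> 'e \<times> 'e \<Rightarrow> 'e::real_vector \<times> 'e" where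
  "cscale z = (\<lambda>(x, y). (Re z *\<^sub>R x - Im z *\<^sub>R y, Im z *\<^sub>R x + Re z *\<^sub>R y))"

definition spectrum :: "('e::real_normed_vector \<Rightarrow> 'e) \<Rightarrow> complex set" where
  "spectrum T =
     {z. \<not> (\<exists>S. bounded_linear S \<and>
              (\<forall>p. S (cscale z p - complexify T p) = p) \<and>
              (\<forall>p. cscale z (S p) - complexify T (S p) = p))}"

definition spectral_radius :: "('e::real_normed_vector \<Rightarrow> 'e) \<Rightarrow> real" where
  "spectral_radius T = (SUP z\<in>spectrum T. cmod z)"

section \<open>The subshift and unique ergodicity\<close>

definition subst_language :: "('a::topological_space \<Rightarrow> 'a list) \<Rightarrow> 'a list set" where
  "subst_language \<rho> = word_topology closure_of {u. \<exists>n a. sublist u (subst_iter \<rho> n a)}"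

definition subword_biinf :: "'a list \<Rightarrow> (int \<Rightarrow> 'a) \<Rightarrow> bool" where
  "subword_biinf u w \<longleftrightarrow> (\<exists>k. u = map (\<lambda>i. w (k + int i)) [0..<length u])"

definition subshift :: "('a::topological_space \<Rightarrow> 'a list) \<Rightarrow> (int \<Rightarrow> 'a) set" where
  "subshift \<rho> = {w. \<forall>u. subword_biinf u w \<longrightarrow> u \<in> subst_language \<rho>}"

definition left_shift :: "(int \<Rightarrow> 'a) \<Rightarrow> (int \<Rightarrow> 'a)" where
  "left_shift w = (\<lambda>i. w (i + 1))"

text \<open>
  \<open>C_metric X\<close> is the space \<open>C(X)\<close> with the sup metric, for a compact subspace \<open>X\<close>: its points are
  the continuous real functions on \<open>X\<close>, taken to be \<open>undefined\<close> outside \<open>X\<close>. Functionals on it are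
  in turn \<open>undefined\<close> outside \<open>C(X)\<close>, so that equality of measures is equality of functionals.
\<close>

abbreviation C_metric :: "'x::topological_space set \<Rightarrow> ('x \<Rightarrow> real) metric" where
  "C_metric X \<equiv> cfunspace (top_of_set X) euclidean_metric"

abbreviation C_space :: "'x::topological_space set \<Rightarrow> ('x \<Rightarrow> real) set" where
  "C_space X \<equiv> mspace (C_metric X)"

definition measure_on :: "'x::topological_space set \<Rightarrow> (('x \<Rightarrow> real) \<Rightarrow> real) \<Rightarrow> bool" where
  "measure_on X \<mu> \<longleftrightarrow>
     \<mu> \<in> extensional (C_space X) \<and>
     (\<forall>f\<in>C_space X. \<forall>g\<in>C_space X. \<mu> (\<lambda>x\<in>X. f x + g x) = \<mu> f + \<mu> g) \<and>
     (\<forall>c. \<forall>f\<in>C_space X. \<mu> (\<lambda>x\<in>X. c * f x) = c * \<mu> f) \<and>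
     (\<forall>f\<in>C_space X. (\<forall>x\<in>X. 0 \<le> f x) \<longrightarrow> 0 \<le> \<mu> f) \<and>
     continuous_map (mtopology_of (C_metric X)) euclidean \<mu>"

definition probability_on :: "'x::topological_space set \<Rightarrow> (('x \<Rightarrow> real) \<Rightarrow> real) \<Rightarrow> bool" where
  "probability_on X \<mu> \<longleftrightarrow> measure_on X \<mu> \<and> \<mu> (\<lambda>x\<in>X. 1) = 1"

definition invariant_on ::
    "'x set \<Rightarrow> ('x \<Rightarrow> 'x) \<Rightarrow> (('x::topological_space \<Rightarrow> real) \<Rightarrow> real) \<Rightarrow> bool" where
  "invariant_on X \<sigma> \<mu> \<longleftrightarrow> (\<forall>f\<in>C_space X. \<mu> (\<lambda>x\<in>X. f (\<sigma> x)) = \<mu> f)"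

definition uniquely_ergodic :: "(int \<Rightarrow> 'a::topological_space) set \<Rightarrow> bool" where
  "uniquely_ergodic X \<longleftrightarrow> (\<exists>!\<mu>. probability_on X \<mu> \<and> invariant_on X left_shift \<mu>)"

end

theory Submission
  imports Defs
begin

text \<open>
  Irreducibility forces every word \<open>\<rho>\<^sup>n(a)\<close> to be long once \<open>n\<close> is large, uniformly in \<open>a\<close>. Unique
  ergodicity makes the mean of \<open>b \<mapsto> #\<rho>(b)\<close> over long legal words converge uniformly to a constant
  \<open>r\<close>, and this mean over \<open>\<rho>\<^sup>n(a)\<close> is the quotient \<open>#\<rho>\<^sup>n\<^sup>+\<^sup>1(a) / #\<rho>\<^sup>n(a)\<close>. So these quotients tend to
  \<open>r\<close> uniformly in \<open>a\<close>, which gives the two bounds with \<open>r\<close>. It remains to identify \<open>r\<close> with the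
  spectral radius: the functions \<open>M\<^sup>n 1 = #\<rho>\<^sup>n\<close> are approximate eigenvectors for \<open>r\<close>, and for
  \<open>|z| > r\<close> the Neumann series inverts \<open>z - M\<close>, because the growth bound on \<open>\<parallel>M\<^sup>n\<parallel> = sup #\<rho>\<^sup>n\<close> holds.
\<close>

section \<open>Uniform convergence of ergodic averages\<close>

lemma C_space_iff:
  fixes X :: "'x::topological_space set"
  shows "f \<in> C_space X \<longleftrightarrow> f \<in> extensional X \<and> bounded (f ` X) \<and> continuous_on X f"
proof -
  have "Metric_space.mbounded (UNIV::real set) dist S = bounded S" for S
    using mbounded_iff_bounded[of S] by (simp add: mspace_euclidean_metric)
  then show ?thesis by auto
qed

text \<open>Plays the role of an ultrafilter in extracting a limit functional.\<close>

lemma pointwise_cluster_filter: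
  fixes \<phi> :: "nat \<Rightarrow> 'i \<Rightarrow> real"
  assumes bound: "\<And>n i. \<bar>\<phi> n i\<bar> \<le> B i"
  obtains F l where "F \<noteq> bot" "F \<le> sequentially" "\<And>i. ((\<lambda>n. \<phi> n i) \<longlongrightarrow> l i) F"
proof -
  have in_box: "\<phi> n \<in> PiE UNIV (\<lambda>i. {- B i..B i})" for n
    using bound[of n] by (auto simp: abs_le_iff minus_le_iff)
  \<comment> \<open>By Tychonoff the box containing every \<open>\<phi> n\<close> is compact, so the
    image filter has a cluster point \<open>l\<close>.\<close>
  have "compact (PiE UNIV (\<lambda>i. {- B i..B i}))"
    using compactin_PiE[of "\<lambda>_. euclidean" UNIV "\<lambda>i. {- B i..B i}"]
    by (simp add: euclidean_product_topology)
  moreover have "eventually (\<lambda>x. x \<in> PiE UNIV (\<lambda>i. {- B i..B i})) (filtermap \<phi> sequentially)"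
    using in_box by (simp add: eventually_filtermap)
  ultimately obtain l where l: "inf (nhds l) (filtermap \<phi> sequentially) \<noteq> bot"
    unfolding compact_filter by (meson filtermap_bot_iff sequentially_bot)
  \<comment> \<open>Pulling the neighbourhoods of \<open>l\<close> back along \<open>\<phi>\<close>
    makes \<open>\<phi>\<close> converge to \<open>l\<close>. The filter is proper because otherwise
    some neighbourhood of \<open>l\<close> would eventually be missed.\<close>
  define F where "F = inf (filtercomap \<phi> (nhds l)) sequentially"
  have "F \<noteq> bot"
  proof
    assume "F = bot"
    then have "eventually (\<lambda>_. False) F" by simp
    then obtain P Q where "eventually P (filtercomap \<phi> (nhds l))" and Q: "eventually Q sequentially"
      and PQ: "\<And>n. P n \<Longrightarrow> Q n \<Longrightarrow> False"
      unfolding F_def eventually_inf by blast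
    then obtain R where R: "eventually R (nhds l)" "\<And>n. R (\<phi> n) \<Longrightarrow> P n"
      by (auto simp: eventually_filtercomap)
    have "eventually (\<lambda>x. \<not> R x) (filtermap \<phi> sequentially)"
      using Q by (auto simp: eventually_filtermap elim!: eventually_mono dest: PQ R(2))
    with R(1) have "eventually (\<lambda>_. False) (inf (nhds l) (filtermap \<phi> sequentially))"
      unfolding eventually_inf by blast
    with l show False by (simp add: trivial_limit_def)
  qed
  moreover have "F \<le> sequentially" by (simp add: F_def)
  moreover have "((\<lambda>n. \<phi> n i) \<longlongrightarrow> l i) F" for i
  proof -
    have "(\<phi> \<longlongrightarrow> l) F"
      unfolding filterlim_def F_def
      by (meson filtermap_filtercomap filtermap_mono inf_le1 order_trans)
    from continuous_on_tendsto_compose[OF continuous_on_product_coordinates[of i] this]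
    show ?thesis by simp
  qed
  ultimately show ?thesis using that by blast
qed

text \<open>Krylov-Bogoliubov by contradiction: if every length has a bad starting point, the orbit
  averages from these points have a cluster functional that is an invariant probability measure.
  Uniqueness identifies it with \<open>\<nu>\<close>, but at \<open>f\<close> it stays at distance
  at least \<open>e\<close> from \<open>\<nu> f\<close>.\<close>

lemma birkhoff_average_uniform:
  fixes X :: "'x::topological_space set" and \<nu> :: "('x \<Rightarrow> real) \<Rightarrow> real" and e :: real
  assumes T: "continuous_on X T" "T ` X \<subseteq> X"
    and unique: "\<And>\<mu>. probability_on X \<mu> \<Longrightarrow> invariant_on X T \<mu> \<Longrightarrow> \<mu> = \<nu>"
    and f: "f \<in> C_space X" and "0 < e"
  shows "\<exists>m>0. \<forall>x\<in>X. \<bar>(\<Sum>i<m. f ((T ^^ i) x)) - m * \<nu> f\<bar> < e * m"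
proof (rule ccontr)
  assume "\<not> ?thesis"
  then have "\<forall>n. \<exists>x\<in>X. e * Suc n \<le> \<bar>(\<Sum>i<Suc n. f ((T ^^ i) x)) - Suc n * \<nu> f\<bar>"
    by (force simp: not_less)
  then obtain x where xX: "\<And>n. x n \<in> X"
    and x: "\<And>n. e * Suc n \<le> \<bar>(\<Sum>i<Suc n. f ((T ^^ i) (x n))) - Suc n * \<nu> f\<bar>"
    by metis
  \<comment> \<open>A limit of these empirical functionals is an invariant probability measure other than \<open>\<nu>\<close>.\<close>
  define A where "A n g = (if g \<in> C_space X then (\<Sum>i<Suc n. g ((T ^^ i) (x n))) / Suc n else 0)"
    for n and g :: "'x \<Rightarrow> real"
  have orbit: "(T ^^ i) y \<in> X" if "y \<in> X" for i y
    using that T(2) by (induction i) auto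
  have A_le: "\<bar>A n g\<bar> \<le> c" if g: "g \<in> C_space X" and c: "\<And>y. y \<in> X \<Longrightarrow> \<bar>g y\<bar> \<le> c" for n g c
  proof -
    have "\<bar>\<Sum>i<Suc n. g ((T ^^ i) (x n))\<bar> \<le> (\<Sum>i<Suc n. c)"
      by (rule order_trans[OF sum_abs sum_mono]) (use c orbit xX in blast)
    then show ?thesis using g by (simp add: A_def divide_le_eq algebra_simps)
  qed
  \<comment> \<open>The default value 0 off \<open>C_space X\<close> makes \<open>A\<close> bounded
    at every index \<open>g\<close>, as \<open>pointwise_cluster_filter\<close> demands.\<close>
  have "\<exists>c. \<forall>n. \<bar>A n g\<bar> \<le> c" for g
  proof (cases "g \<in> C_space X")
    case True
    then obtain c where "\<And>y. y \<in> X \<Longrightarrow> \<bar>g y\<bar> \<le> c"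
      by (auto simp only: C_space_iff bounded_iff image_iff real_norm_def)
    with True A_le show ?thesis by blast
  next
    case False
    then show ?thesis by (auto simp only: A_def if_False)
  qed
  then obtain c where "\<And>n g. \<bar>A n g\<bar> \<le> c g" by metis
  then obtain F l where F: "F \<noteq> bot" "F \<le> sequentially"
    and l: "\<And>g. ((\<lambda>n. A n g) \<longlongrightarrow> l g) F"
    using pointwise_cluster_filter[of A c] by blast
  define \<mu> where "\<mu> = restrict l (C_space X)"
  have \<mu>: "\<mu> g = l g" if "g \<in> C_space X" for g
    using that by (simp only: \<mu>_def restrict_apply if_True)
  have lim_eq: "l g = c" if "((\<lambda>n. A n g) \<longlongrightarrow> c) F" for g c
    using tendsto_unique[OF F(1) l that] .
  have plus_C: "(\<lambda>x\<in>X. g x + h x) \<in> C_space X" if "g \<in> C_space X" "h \<in> C_space X" for g h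
    using that unfolding C_space_iff
    by (auto intro!: continuous_intros bounded_plus_comp cong: continuous_on_cong)
  have scale_C: "(\<lambda>x\<in>X. a * g x) \<in> C_space X" if "g \<in> C_space X" for g a
    using that bounded_scaleR_comp[of g X a] unfolding C_space_iff
    by (auto intro!: continuous_intros cong: continuous_on_cong)
  have shift_C: "(\<lambda>x\<in>X. g (T x)) \<in> C_space X" if "g \<in> C_space X" for g
  proof -
    have "bounded ((\<lambda>x. g (T x)) ` X)"
      using that T(2) unfolding C_space_iff
      by (metis bounded_subset image_image image_mono)
    moreover have "continuous_on X (\<lambda>x. g (T x))"
      using that T continuous_on_compose2[of X g X T] unfolding C_space_iff by blast
    ultimately show ?thesis unfolding C_space_iff by (auto cong: continuous_on_cong)
  qed
  have one_C: "(\<lambda>x\<in>X. 1) \<in> C_space X"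
    unfolding C_space_iff by (auto simp: bounded_iff cong: continuous_on_cong)
  have add: "l (\<lambda>x\<in>X. g x + h x) = l g + l h" if "g \<in> C_space X" "h \<in> C_space X" for g h
  proof (rule lim_eq)
    have "A n (\<lambda>x\<in>X. g x + h x) = A n g + A n h" for n
      using that plus_C[OF that] orbit[OF xX] by (simp only: A_def if_True)
        (simp add: sum.distrib add_divide_distrib)
    then show "((\<lambda>n. A n (\<lambda>x\<in>X. g x + h x)) \<longlongrightarrow> l g + l h) F"
      using tendsto_add[OF l[of g] l[of h]] by simp
  qed
  have scale: "l (\<lambda>x\<in>X. a * g x) = a * l g" if "g \<in> C_space X" for a g
  proof (rule lim_eq)
    have "A n (\<lambda>x\<in>X. a * g x) = a * A n g" for n
      using that scale_C[OF that] orbit[OF xX] by (simp only: A_def if_True)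
        (simp add: sum_distrib_left distrib_left)
    then show "((\<lambda>n. A n (\<lambda>x\<in>X. a * g x)) \<longlongrightarrow> a * l g) F"
      using tendsto_mult_left[OF l[of g]] by simp
  qed
  have pos: "0 \<le> l g" if "g \<in> C_space X" "\<forall>x\<in>X. 0 \<le> g x" for g
  proof (rule tendsto_lowerbound[OF l _ F(1)])
    show "\<forall>\<^sub>F n in F. 0 \<le> A n g"
      using that orbit[OF xX] by (intro always_eventually allI)
        (simp only: A_def if_True, intro divide_nonneg_pos sum_nonneg, auto)
  qed
  have one: "l (\<lambda>x\<in>X. 1) = 1"
  proof (rule lim_eq)
    have "A n (\<lambda>x\<in>X. 1) = 1" for n
      using one_C orbit[OF xX] by (simp only: A_def if_True) simp
    then show "((\<lambda>n. A n (\<lambda>x\<in>X. 1)) \<longlongrightarrow> 1) F" by simp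
  qed
  have invariant: "l (\<lambda>x\<in>X. g (T x)) = l g" if g: "g \<in> C_space X" for g
  proof -
    obtain c where c: "\<And>y. y \<in> X \<Longrightarrow> \<bar>g y\<bar> \<le> c"
      using g by (auto simp only: C_space_iff bounded_iff image_iff real_norm_def)
    \<comment> \<open>Along an orbit the two sums telescope to their end terms, so the averages
      differ by at most \<open>2 * c / Suc n\<close>. This vanishes along \<open>F\<close> because
      \<open>F\<close> is finer than \<open>sequentially\<close>.\<close>
    have bound: "\<bar>A n (\<lambda>x\<in>X. g (T x)) - A n g\<bar> \<le> 2 * c * (1 / Suc n)" for n
    proof -
      let ?h = "\<lambda>i. g ((T ^^ i) (x n))"
      have "A n (\<lambda>x\<in>X. g (T x)) - A n g = ((\<Sum>i<Suc n. ?h (Suc i)) - (\<Sum>i<Suc n. ?h i)) / Suc n"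
        using g shift_C[OF g] orbit[OF xX] by (simp only: A_def if_True)
          (simp add: diff_divide_distrib)
      also have "(\<Sum>i<Suc n. ?h (Suc i)) - (\<Sum>i<Suc n. ?h i) = ?h (Suc n) - ?h 0"
        using sum_lessThan_telescope[of ?h "Suc n"] by (simp only: sum_subtractf)
      finally have "A n (\<lambda>x\<in>X. g (T x)) - A n g = (?h (Suc n) - ?h 0) / Suc n" .
      moreover have "\<bar>?h (Suc n) - ?h 0\<bar> \<le> 2 * c"
        using c[OF orbit[OF xX, of "Suc n" n]] c[OF orbit[OF xX, of 0 n]] by linarith
      ultimately show ?thesis by (simp add: divide_right_mono)
    qed
    have "((\<lambda>n. 2 * c * (1 / Suc n)) \<longlongrightarrow> 0) F"
      by (rule tendsto_mono[OF F(2) tendsto_mult_right_zero[OF lim_1_over_n[THEN LIMSEQ_Suc]]])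
    then have "((\<lambda>n. A n (\<lambda>x\<in>X. g (T x)) - A n g) \<longlongrightarrow> 0) F"
      by (rule Lim_null_comparison[rotated]) (use bound in auto)
    from tendsto_add[OF this l[of g]] show ?thesis by (intro lim_eq) simp
  qed
  \<comment> \<open>Each average is 1-Lipschitz for the sup metric, and the bound survives the
    limit; this gives the continuity of \<open>\<mu>\<close>.\<close>
  have dist_le: "\<bar>l g - l h\<bar> \<le> mdist (C_metric X) g h"
    if g: "g \<in> C_space X" and h: "h \<in> C_space X" for g h
  proof -
    define d where "d = mdist (C_metric X) g h"
    have d: "\<bar>g y - h y\<bar> \<le> d" if "y \<in> X" for y
      using mdist_cfunspace_imp_mdist_le[OF g h order_refl, of y] that
      by (simp add: d_def dist_real_def)
    have "\<bar>A n g - A n h\<bar> \<le> d" for n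
    proof -
      have "A n g - A n h = A n (\<lambda>x\<in>X. g x + (\<lambda>x\<in>X. - 1 * h x) x)"
        using g h scale_C[OF h, of "-1"] plus_C[OF g scale_C[OF h, of "-1"]] orbit[OF xX]
        by (simp only: A_def if_True) (simp add: sum_subtractf diff_divide_distrib)
      also have "\<bar>\<dots>\<bar> \<le> d"
        using d by (intro A_le plus_C[OF g scale_C[OF h, of "-1"]]) simp
      finally show ?thesis .
    qed
    then show ?thesis
      unfolding d_def[symmetric]
      by (intro tendsto_upperbound[OF tendsto_rabs[OF tendsto_diff[OF l l]] _ F(1)]) auto
  qed
  have "continuous_map (mtopology_of (C_metric X)) euclidean \<mu>"
  proof -
    have "Lipschitz_continuous_map (C_metric X) euclidean_metric \<mu>"
      unfolding Lipschitz_continuous_map_def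
    proof (intro conjI exI[of _ 1] ballI)
      show "mdist euclidean_metric (\<mu> g) (\<mu> h) \<le> 1 * mdist (C_metric X) g h"
        if "g \<in> C_space X" "h \<in> C_space X" for g h
        using dist_le[OF that] by (simp only: \<mu> that) (simp add: dist_real_def)
    qed simp
    then show ?thesis
      using Lipschitz_continuous_imp_continuous_map by fastforce
  qed
  with add scale pos plus_C scale_C have "measure_on X \<mu>"
    unfolding measure_on_def by (auto simp only: \<mu>) (auto simp only: \<mu>_def restrict_extensional)
  then have "probability_on X \<mu>"
    unfolding probability_on_def using one one_C by (simp only: \<mu> simp_thms)
  moreover have "invariant_on X T \<mu>"
    unfolding invariant_on_def using invariant shift_C by (intro ballI) (simp only: \<mu>)
  ultimately have "\<mu> = \<nu>" by (rule unique)
  then have "l f = \<nu> f" using f \<mu> by metis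
  have "e \<le> \<bar>A n f - \<nu> f\<bar>" for n
  proof -
    have "A n f - \<nu> f = ((\<Sum>i<Suc n. f ((T ^^ i) (x n))) - Suc n * \<nu> f) / Suc n"
      using f by (simp only: A_def if_True) (simp add: diff_divide_distrib)
    then show ?thesis using x[of n] by (simp add: pos_le_divide_eq)
  qed
  then have "e \<le> \<bar>l f - \<nu> f\<bar>"
    by (intro tendsto_lowerbound[OF tendsto_rabs[OF tendsto_diff[OF l tendsto_const]] _ F(1)]) auto
  with \<open>l f = \<nu> f\<close> \<open>0 < e\<close> show False by simp
qed

section \<open>Words, windows and the subshift\<close>

lemma subst_iter_0 [simp]: "subst_iter \<rho> 0 a = [a]"
  by (simp add: subst_iter_def)

lemma subst_iter_Suc: "subst_iter \<rho> (Suc n) a = subst_word \<rho> (subst_iter \<rho> n a)"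
  by (simp add: subst_iter_def)

lemma funpow_subst_word: "(subst_word \<rho> ^^ n) u = concat (map (subst_iter \<rho> n) u)"
proof -
  have "(subst_word \<rho> ^^ n) [] = []" by (induction n) (auto simp: subst_word_def)
  moreover have "(subst_word \<rho> ^^ n) (u @ v) = (subst_word \<rho> ^^ n) u @ (subst_word \<rho> ^^ n) v" for u v
    by (induction n arbitrary: u v) (auto simp: subst_word_def)
  then have "(subst_word \<rho> ^^ n) (b # u) = subst_iter \<rho> n b @ (subst_word \<rho> ^^ n) u" for b u
    unfolding subst_iter_def by (metis append_Cons append_Nil)
  ultimately show ?thesis by (induction u) auto
qed

text \<open>Here the innermost application of \<open>\<rho>\<close> is peeled off, whereas
  \<open>subst_iter_Suc\<close> peels off the outermost. It exhibits the n-th iterates of the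
  letters of \<open>\<rho> a\<close> as blocks of the next iterate of \<open>a\<close>.\<close>

lemma subst_iter_Suc_left: "subst_iter \<rho> (Suc n) a = concat (map (subst_iter \<rho> n) (\<rho> a))"
  unfolding subst_iter_def[of \<rho> "Suc n"] funpow_Suc_right o_def funpow_subst_word[symmetric]
  by (simp add: subst_word_def)

lemma sum_list_subst_word: "(\<Sum>b\<leftarrow>subst_word \<rho> u. f b) = (\<Sum>b\<leftarrow>u. \<Sum>c\<leftarrow>\<rho> b. f c)"
  by (induction u) (auto simp: subst_word_def)

lemma length_subst_word: "length (subst_word \<rho> u) = (\<Sum>b\<leftarrow>u. length (\<rho> b))"
  by (simp add: subst_word_def length_concat o_def)

lemma sum_lessThan_add:
  fixes f :: "nat \<Rightarrow> 'b::comm_monoid_add"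
  shows "(\<Sum>i<a + b. f i) = (\<Sum>i<a. f i) + (\<Sum>i<b. f (a + i))"
  by (induction b) (auto simp: add.assoc)

text \<open>Cut the range of summation into consecutive blocks of length \<open>m\<close>. Full
  blocks contribute at most \<open>e\<close> per term, and the fewer than \<open>m\<close> leftover
  terms contribute at most \<open>m * K\<close>.\<close>

lemma abs_sum_blocks_le:
  fixes x :: "nat \<Rightarrow> real"
  assumes "0 < m" and block: "\<And>j. p \<le> j \<Longrightarrow> j + m \<le> q \<Longrightarrow> \<bar>\<Sum>i<m. x (j + i)\<bar> \<le> e * m"
    and "0 \<le> e" and K: "\<And>i. p \<le> i \<Longrightarrow> i < q \<Longrightarrow> \<bar>x i\<bar> \<le> K" and "0 \<le> K"
    and "p \<le> s" "s + d \<le> q"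
  shows "\<bar>\<Sum>i<d. x (s + i)\<bar> \<le> e * d + m * K"
  using \<open>p \<le> s\<close> \<open>s + d \<le> q\<close>
proof (induction d arbitrary: s rule: less_induct)
  case (less d)
  show ?case
  proof (cases "d < m")
    case True
    have "\<bar>\<Sum>i<d. x (s + i)\<bar> \<le> (\<Sum>i<d. K)"
      by (rule order_trans[OF sum_abs sum_mono]) (use K less.prems in auto)
    also have "\<dots> \<le> m * K" using True \<open>0 \<le> K\<close> by (simp add: mult_right_mono)
    finally show ?thesis using \<open>0 \<le> e\<close> by (simp add: add_increasing)
  next
    case False
    then obtain d' where d: "d = m + d'" using le_Suc_ex not_less by blast
    have "\<bar>\<Sum>i<d'. x (s + m + i)\<bar> \<le> e * d' + m * K"
      using less.prems d \<open>0 < m\<close> by (intro less.IH) auto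
    moreover have "\<bar>\<Sum>i<m. x (s + i)\<bar> \<le> e * m"
      using less.prems d by (intro block) auto
    moreover have "(\<Sum>i<d. x (s + i)) = (\<Sum>i<m. x (s + i)) + (\<Sum>i<d'. x (s + m + i))"
      using sum_lessThan_add[of "\<lambda>i. x (s + i)" m d'] by (simp add: d add.assoc)
    ultimately show ?thesis by (simp add: d algebra_simps)
  qed
qed

abbreviation window :: "int \<Rightarrow> nat \<Rightarrow> (int \<Rightarrow> 'a) \<Rightarrow> 'a list" where
  "window k n w \<equiv> map (\<lambda>i. w (k + int i)) [0..<n]"

lemma topspace_word_topology: "topspace word_topology = UNIV"
  by (auto simp: word_topology_def topspace_pullback_topology PiE_iff)

text \<open>All windows have the same length \<open>n\<close>, so the map factors through the n-th
  summand of the disjoint union, where continuity is coordinatewise.\<close>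

lemma continuous_map_window:
  "continuous_map euclidean word_topology (window k n :: (int \<Rightarrow> 'a::topological_space) \<Rightarrow> 'a list)"
  unfolding word_topology_def
proof (rule continuous_map_pullback')
  let ?P = "\<lambda>n::nat. product_topology (\<lambda>_. euclidean :: 'a topology) {..<n}"
  have "continuous_map euclidean (?P n) (\<lambda>w. \<lambda>i\<in>{..<n}. w (k + int i))"
    unfolding continuous_map_componentwise by (auto cong: continuous_on_cong)
  from continuous_map_compose[OF this continuous_map_component_injection[of n UNIV ?P]]
  have "continuous_map euclidean (sum_topology ?P UNIV) (\<lambda>w. (n, \<lambda>i\<in>{..<n}. w (k + int i)))"
    by (simp add: o_def)
  moreover have "(\<lambda>i\<in>{..<n}. w (k + int i)) = (\<lambda>i\<in>{..<n}. window k n w ! i)" for w :: "int \<Rightarrow> 'a"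
    by auto
  ultimately show "continuous_map euclidean (sum_topology ?P UNIV)
      ((\<lambda>u. (length u, \<lambda>i\<in>{..<length u}. u ! i)) \<circ> window k n)"
    by (simp add: o_def)
qed simp

lemma closed_window_language: "closed {w. window k n w \<in> subst_language \<rho>}"
proof -
  have "closedin word_topology (subst_language \<rho>)"
    by (simp add: subst_language_def)
  from closedin_continuous_map_preimage[OF continuous_map_window this]
  show ?thesis by simp
qed

lemma subshift_iff: "w \<in> subshift \<rho> \<longleftrightarrow> (\<forall>k n. window k n w \<in> subst_language \<rho>)"
proof
  assume w: "w \<in> subshift \<rho>"
  have "subword_biinf (window k n w) w" for k n
    unfolding subword_biinf_def by auto
  with w show "\<forall>k n. window k n w \<in> subst_language \<rho>" by (simp add: subshift_def)
next
  assume w: "\<forall>k n. window k n w \<in> subst_language \<rho>"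
  have "u \<in> subst_language \<rho>" if u: "subword_biinf u w" for u
  proof -
    obtain k where k: "u = window k (length u) w"
      using u unfolding subword_biinf_def by blast
    have "window k (length u) w \<in> subst_language \<rho>" using w by blast
    then show ?thesis by (simp only: flip: k)
  qed
  then show "w \<in> subshift \<rho>" by (simp add: subshift_def)
qed

lemma compact_biinfinite:
  assumes "compact (UNIV :: 'a::topological_space set)"
  shows "compact (UNIV :: (int \<Rightarrow> 'a) set)"
  using compactin_PiE[of "\<lambda>_. euclidean :: 'a topology" "UNIV :: int set" "\<lambda>_. UNIV"] assms
  by (simp add: euclidean_product_topology)

lemma left_shift_power: "(left_shift ^^ i) w j = w (j + int i)"
  by (induction i arbitrary: j) (auto simp: left_shift_def algebra_simps)

lemma continuous_left_shift: "continuous_on S (left_shift :: (int \<Rightarrow> 'a::topological_space) \<Rightarrow> _)"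
  unfolding left_shift_def
  by (intro continuous_on_coordinatewise_then_product continuous_on_subset[OF continuous_on_product_coordinates]) auto

lemma left_shift_subshift: "left_shift ` subshift \<rho> \<subseteq> subshift \<rho>"
proof safe
  fix w assume w: "w \<in> subshift \<rho>"
  have "window k n (left_shift w) \<in> subst_language \<rho>" for k n
  proof -
    have "window k n (left_shift w) = window (k + 1) n w"
      by (simp add: left_shift_def algebra_simps)
    also have "\<dots> \<in> subst_language \<rho>" using w unfolding subshift_iff by blast
    finally show ?thesis .
  qed
  then show "left_shift w \<in> subshift \<rho>" unfolding subshift_iff by blast
qed

text \<open>
  Closed outer approximations of the subshift, which unlike the subshift itself contain arbitrary
  extensions of finite legal words.
\<close>

definition central_subshift :: "('a::topological_space \<Rightarrow> 'a list) \<Rightarrow> nat \<Rightarrow> (int \<Rightarrow> 'a) set" where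
  "central_subshift \<rho> N =
     {w. \<forall>k n. - int N \<le> k \<longrightarrow> k + int n \<le> int N \<longrightarrow> window k n w \<in> subst_language \<rho>}"

lemma closed_central_subshift: "closed (central_subshift \<rho> N)"
  unfolding central_subshift_def
  by (intro closed_Collect_all closed_Collect_imp closed_window_language) auto

lemma central_subshift_antimono: "N \<le> N' \<Longrightarrow> central_subshift \<rho> N' \<subseteq> central_subshift \<rho> N"
  unfolding central_subshift_def by force

lemma INT_central_subshift: "(\<Inter>N. central_subshift \<rho> N) \<subseteq> subshift \<rho>"
proof
  fix w assume w: "w \<in> (\<Inter>N. central_subshift \<rho> N)"
  have "window k n w \<in> subst_language \<rho>" for k n
  proof -
    have "w \<in> central_subshift \<rho> (nat \<bar>k\<bar> + n)" using w by blast
    then show ?thesis unfolding central_subshift_def by (simp add: abs_if split: if_splits)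
  qed
  then show "w \<in> subshift \<rho>" by (simp add: subshift_iff)
qed

text \<open>The approximations are closed and decreasing, and their intersection lies in
  \<open>U\<close>; compactness of the complement of \<open>U\<close> leaves finitely many of them
  to consider.\<close>

lemma central_subshift_subset_open:
  assumes "compact (UNIV :: 'a::topological_space set)" and "open U"
    and "subshift (\<rho> :: 'a \<Rightarrow> 'a list) \<subseteq> U"
  shows "\<exists>N. central_subshift \<rho> N \<subseteq> U"
proof -
  have "- U \<inter> (\<Inter>N. central_subshift \<rho> N) = {}"
    using INT_central_subshift[of \<rho>] assms(3) by blast
  moreover have "compact (- U)"
    using closed_Int_compact[OF _ compact_biinfinite[OF assms(1)], of "- U"] \<open>open U\<close>
    by (simp add: closed_Compl)
  ultimately obtain I where I: "finite I" "- U \<inter> (\<Inter>N\<in>I. central_subshift \<rho> N) = {}"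
    using compact_imp_fip_image[of "- U" UNIV "central_subshift \<rho>"] closed_central_subshift[of \<rho>]
    by blast
  \<comment> \<open>By monotonicity the largest index suffices; inserting 0 covers the case that
    \<open>I\<close> is empty.\<close>
  have "central_subshift \<rho> (Max (insert 0 I)) \<subseteq> (\<Inter>N\<in>I. central_subshift \<rho> N)"
    using I(1) by (intro INT_greatest central_subshift_antimono) auto
  with I(2) show ?thesis by blast
qed

text \<open>From a position at distance at least \<open>N\<close> from both ends of
  \<open>u\<close>, every window within \<open>[-N, N]\<close> reads only letters of
  \<open>u\<close>, so it is a subword of an iterate whatever \<open>w\<close> does outside
  \<open>u\<close>.\<close>

lemma subst_iter_in_central_subshift:
  assumes u: "u = subst_iter \<rho> n a" and w: "\<And>i. i < length u \<Longrightarrow> w (int i) = u ! i"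
    and "N \<le> j" "j + N \<le> length u"
  shows "(left_shift ^^ j) w \<in> central_subshift \<rho> N"
  unfolding central_subshift_def
proof (clarsimp simp: left_shift_power)
  fix k l assume k: "- int N \<le> k" "k + int l \<le> int N"
  define s where "s = nat (k + int j)"
  have s: "k + int j = int s" "s + l \<le> length u"
    using k assms by (auto simp: s_def)
  have "map (\<lambda>i. w (k + int i + int j)) [0..<l] = take l (drop s u)"
  proof (rule nth_equalityI)
    fix i assume i: "i < length (map (\<lambda>i. w (k + int i + int j)) [0..<l])"
    have "w (k + int i + int j) = w (int (s + i))" using s(1) by (intro arg_cong[of _ _ w]) simp
    also have "\<dots> = u ! (s + i)" using i s(2) by (intro w) simp
    finally show "map (\<lambda>i. w (k + int i + int j)) [0..<l] ! i = take l (drop s u) ! i"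
      using i s(2) by simp
  qed (use s in auto)
  moreover have "sublist (take l (drop s u)) u"
    by (meson sublist_drop sublist_order.order_trans sublist_take)
  ultimately have "map (\<lambda>i. w (k + int i + int j)) [0..<l] \<in> {v. \<exists>n a. sublist v (subst_iter \<rho> n a)}"
    using u by auto
  then show "map (\<lambda>i. w (k + int i + int j)) [0..<l] \<in> subst_language \<rho>"
    unfolding subst_language_def
    using closure_of_subset[of "{v. \<exists>n a. sublist v (subst_iter \<rho> n a)}" word_topology]
    by (auto simp: topspace_word_topology)
qed

section \<open>Spectra of power-bounded operators\<close>

text \<open>
  The library makes \<open>'x \<Rightarrow>\<^sub>C 'b\<close> an instance of \<open>banach\<close> only for metric \<open>'x\<close>, so completeness enters
  below as the assumption that absolutely convergent series converge.
\<close>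

lemma summable_bcontfun:
  fixes f :: "nat \<Rightarrow> 'x::topological_space \<Rightarrow>\<^sub>C 'b::banach"
  assumes "summable (\<lambda>n. norm (f n))"
  shows "summable f"
proof -
  have apply_sum: "apply_bcontfun (\<Sum>i<n. f i) = (\<lambda>x. \<Sum>i<n. f i x)" for n
    by (induction n) auto
  have "uniform_limit UNIV (\<lambda>n x. \<Sum>i<n. f i x) (\<lambda>x. \<Sum>i. f i x) sequentially"
    by (rule Weierstrass_m_test[OF norm_bounded assms])
  then have "uniform_limit UNIV (\<lambda>n. apply_bcontfun (\<Sum>i<n. f i)) (\<lambda>x. \<Sum>i. f i x) sequentially"
    by (simp only: apply_sum)
  then obtain l where "(\<lambda>n. \<Sum>i<n. f i) \<longlonglongrightarrow> l"
    by (rule uniform_limit_bcontfunE) auto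
  then show ?thesis by (auto simp: summable_def sums_def)
qed

text \<open>The decay is demanded of the powers because \<open>U\<close> itself may have norm above
  1. Geometric domination makes the sum of all \<open>U ^^ n\<close> converge to a bounded two-sided
  inverse of \<open>1 - U\<close>.\<close>

lemma neumann_series_inverse:
  fixes U :: "'v::real_normed_vector \<Rightarrow> 'v"
  assumes abs_summable: "\<And>f :: nat \<Rightarrow> 'v. summable (\<lambda>n. norm (f n)) \<Longrightarrow> summable f"
    and U: "bounded_linear U"
    and bound: "\<And>n p. norm ((U ^^ n) p) \<le> C * q ^ n * norm p" and q: "0 \<le> q" "q < 1"
  obtains S where "bounded_linear S" "\<And>p. S (p - U p) = p" "\<And>p. S p - U (S p) = p"
proof
  interpret U: bounded_linear U by fact
  define S where "S p = (\<Sum>n. (U ^^ n) p)" for p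
  have linear: "linear (U ^^ n)" for n
  proof (induction n)
    case 0
    show ?case by (simp add: linear_iff)
  next
    case (Suc n)
    then show ?case by (simp add: linear_iff U.add U.scaleR)
  qed
  have geometric: "summable (\<lambda>n. C * q ^ n * norm p)" for p
    using q by (intro summable_mult summable_mult2 summable_geometric) auto
  then have sm: "summable (\<lambda>n. (U ^^ n) p)" for p
    by (intro abs_summable summable_comparison_test'[OF geometric[of p], of 0]) (use bound in auto)
  have S_U: "S (U p) = S p - p" for p
    using suminf_split_head[OF sm[of p]] by (simp add: S_def funpow_swap1)
  have add: "S (p + p') = S p + S p'" for p p'
    by (simp add: S_def suminf_add[OF sm sm] linear_add[OF linear])
  have scale: "S (a *\<^sub>R p) = a *\<^sub>R S p" for a p
    by (simp add: S_def suminf_scaleR_right[OF sm] linear_scale[OF linear])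
  have "norm (S p) \<le> norm p * (C * (\<Sum>n. q ^ n))" for p
  proof -
    have "norm (\<Sum>i<n. (U ^^ i) p) \<le> norm p * (C * (\<Sum>n. q ^ n))" for n
    proof -
      have "norm (\<Sum>i<n. (U ^^ i) p) \<le> (\<Sum>i<n. C * q ^ i * norm p)"
        by (rule order_trans[OF norm_sum sum_mono]) (rule bound)
      also have "\<dots> \<le> (\<Sum>i. C * q ^ i * norm p)"
        by (intro sum_le_suminf geometric) (auto intro: order_trans[OF norm_ge_zero bound])
      also have "\<dots> = norm p * (C * (\<Sum>n. q ^ n))"
        using q by (simp add: suminf_mult suminf_mult2[symmetric] summable_geometric summable_mult)
      finally show ?thesis .
    qed
    then show ?thesis
      unfolding S_def by (intro LIMSEQ_le_const2[OF tendsto_norm[OF summable_LIMSEQ[OF sm]]]) auto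
  qed
  with add scale show "bounded_linear S" by (rule bounded_linear_intro)
  then interpret S: bounded_linear S .
  show "S (p - U p) = p" for p by (simp add: S.diff S_U)
  have "U (S p) = (\<Sum>n. (U ^^ Suc n) p)" for p
    unfolding S_def by (simp add: U.suminf[OF sm])
  then show "S p - U (S p) = p" for p
    using suminf_split_head[OF sm[of p]] by (simp add: S_def)
qed

section \<open>Complex scalars on the complexification\<close>

lemma cscale_cscale: "cscale v (cscale w p) = cscale (v * w) p"
  by (cases p) (simp add: cscale_def algebra_simps)

lemma cscale_1: "cscale 1 p = p"
  by (cases p) (simp add: cscale_def)

lemma bounded_linear_cscale:
  "bounded_linear (cscale z :: 'e \<times> 'e \<Rightarrow> 'e::real_normed_vector \<times> 'e)"
  unfolding cscale_def case_prod_beta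
  by (intro bounded_linear_Pair bounded_linear_add bounded_linear_sub
        bounded_linear_scaleR_right[THEN bounded_linear_compose] bounded_linear_fst bounded_linear_snd)

lemma bounded_linear_complexify: "bounded_linear T \<Longrightarrow> bounded_linear (complexify T)"
  unfolding complexify_def case_prod_beta
  by (rule bounded_linear_Pair[OF bounded_linear_compose[OF _ bounded_linear_fst]
        bounded_linear_compose[OF _ bounded_linear_snd]])

lemma norm_pair_le_add: "norm (x, y) \<le> norm x + norm y"
  by (simp add: norm_Pair sqrt_sum_squares_le_sum)

lemma add_norm_le_norm_pair: "norm x + norm y \<le> 2 * norm (x, y)"
  using norm_fst_le[of x y] norm_snd_le[of y x] by simp

text \<open>The product norm need not be homogeneous under complex scalars. One factor 2 comes from
  the two real products containing each component, the other from comparing the sum of the norms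
  with the product norm.\<close>

lemma norm_cscale_le: "norm (cscale z p) \<le> 4 * cmod z * norm p"
proof (cases p)
  case (Pair x y)
  have *: "norm (a *\<^sub>R x) \<le> cmod z * norm x" "norm (a *\<^sub>R y) \<le> cmod z * norm y"
    if "\<bar>a\<bar> \<le> cmod z" for a
    using that by (auto simp: mult_right_mono)
  have "norm (cscale z p) \<le> norm (Re z *\<^sub>R x - Im z *\<^sub>R y) + norm (Im z *\<^sub>R x + Re z *\<^sub>R y)"
    using norm_pair_le_add by (simp add: Pair cscale_def)
  also have "\<dots> \<le> 2 * cmod z * (norm x + norm y)"
    using norm_triangle_ineq4[of "Re z *\<^sub>R x" "Im z *\<^sub>R y"] norm_triangle_ineq[of "Im z *\<^sub>R x" "Re z *\<^sub>R y"]
      *[OF abs_Re_le_cmod] *[OF abs_Im_le_cmod] by (simp add: distrib_left)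
  also have "\<dots> \<le> 2 * cmod z * (2 * norm p)"
    using add_norm_le_norm_pair unfolding Pair by (intro mult_left_mono) auto
  finally show ?thesis by simp
qed

text \<open>On the complexification, z - T = z (1 - U) with U = T / z. The powers of
  \<open>U\<close> decay like \<open>(c / cmod z) ^ n\<close>, so the Neumann series inverts
  \<open>1 - U\<close>, and division by \<open>z\<close> completes the resolvent.\<close>

lemma power_bounded_not_in_spectrum:
  fixes T :: "'e::real_normed_vector \<Rightarrow> 'e"
  assumes abs_summable: "\<And>f :: nat \<Rightarrow> 'e. summable (\<lambda>n. norm (f n)) \<Longrightarrow> summable f"
    and T: "bounded_linear T"
    and bound: "\<And>n x. norm ((T ^^ n) x) \<le> C * c ^ n * norm x"
    and c: "0 < c" "c < cmod z"
  shows "z \<notin> spectrum T"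
proof -
  interpret T: bounded_linear T by fact
  define U where "U p = cscale (1 / z) (complexify T p)" for p
  have z: "z \<noteq> 0" using c by auto
  have abs_summable_pair: "summable f" if f: "summable (\<lambda>n. norm (f n))" for f :: "nat \<Rightarrow> 'e \<times> 'e"
  proof -
    have "norm (fst (f n)) \<le> norm (f n)" "norm (snd (f n)) \<le> norm (f n)" for n
      using norm_fst_le[of "fst (f n)" "snd (f n)"] norm_snd_le[of "snd (f n)" "fst (f n)"] by auto
    then have "summable (\<lambda>n. fst (f n))" "summable (\<lambda>n. snd (f n))"
      by (auto intro!: abs_summable summable_comparison_test'[OF f, of 0])
    then have "(\<lambda>n. fst (f n)) sums (\<Sum>n. fst (f n))" "(\<lambda>n. snd (f n)) sums (\<Sum>n. snd (f n))"
      by (simp_all add: summable_sums)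
    from tendsto_Pair[OF this[unfolded sums_def]]
    have "f sums (\<Sum>n. fst (f n), \<Sum>n. snd (f n))"
      by (simp add: sums_def flip: fst_sum snd_sum)
    then show ?thesis by (rule sums_summable)
  qed
  have T_cscale: "complexify T (cscale w p) = cscale w (complexify T p)" for w p
    by (cases p) (simp add: complexify_def cscale_def T.diff T.add T.scaleR)
  have pow: "(U ^^ n) p = cscale ((1 / z) ^ n) (complexify (T ^^ n) p)" for n p
  proof (induction n)
    case 0
    show ?case by (cases p) (simp add: cscale_1 complexify_def)
  next
    case (Suc n)
    then show ?case
      by (cases p) (simp add: U_def T_cscale cscale_cscale, simp add: complexify_def)
  qed
  \<comment> \<open>The 8 is the 4 of \<open>norm_cscale_le\<close> times the 2 of
    \<open>add_norm_le_norm_pair\<close>.\<close>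
  have U_bound: "norm ((U ^^ n) p) \<le> 8 * C * (c / cmod z) ^ n * norm p" for n p
  proof -
    obtain x y where p: "p = (x, y)" by (cases p)
    have C: "0 \<le> C * c ^ n * norm x" for x :: 'e using bound[of n x] norm_ge_zero order_trans by blast
    \<comment> \<open>The power bound forces \<open>C * c ^ n\<close> to be nonnegative unless both
      components of \<open>p\<close> vanish, and then both sides of the estimate are 0.\<close>
    have Cn: "0 \<le> C * c ^ n \<or> (norm x = 0 \<and> norm y = 0)"
      using C[of x] C[of y] by (auto simp: zero_le_mult_iff)
    have "norm (complexify (T ^^ n) p) \<le> C * c ^ n * norm x + C * c ^ n * norm y"
      unfolding complexify_def p prod.case
      using norm_pair_le_add[of "(T ^^ n) x" "(T ^^ n) y"] bound[of n x] bound[of n y] by linarith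
    also have "\<dots> = C * c ^ n * (norm x + norm y)" by (simp add: distrib_left)
    also have "\<dots> \<le> C * c ^ n * (2 * norm p)"
      using Cn add_norm_le_norm_pair[of x y] by (auto simp: p intro: mult_left_mono)
    finally have "norm (complexify (T ^^ n) p) \<le> C * c ^ n * (2 * norm p)" .
    then have "4 * cmod ((1 / z) ^ n) * norm (complexify (T ^^ n) p)
        \<le> 4 * cmod ((1 / z) ^ n) * (C * c ^ n * (2 * norm p))"
      by (intro mult_left_mono) auto
    also have "\<dots> = 8 * C * (c / cmod z) ^ n * norm p"
      by (simp add: norm_power norm_divide power_divide)
    finally show ?thesis using norm_cscale_le[of "(1 / z) ^ n"] order_trans unfolding pow by blast
  qed
  have "bounded_linear U"
    unfolding U_def using bounded_linear_compose[OF bounded_linear_cscale bounded_linear_complexify[OF T]]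
    by simp
  moreover have "0 \<le> c / cmod z" "c / cmod z < 1" using c by (auto simp: divide_less_eq)
  ultimately obtain S where S: "bounded_linear S" "\<And>p. S (p - U p) = p" "\<And>p. S p - U (S p) = p"
    using neumann_series_inverse[OF abs_summable_pair _ U_bound] by blast
  let ?R = "\<lambda>p. S (cscale (1 / z) p)"
  interpret cs: bounded_linear "cscale w :: 'e \<times> 'e \<Rightarrow> _" for w by (rule bounded_linear_cscale)
  have inv: "cscale w (cscale v p) = p" if "w * v = 1" for w v and p :: "'e \<times> 'e"
    using that by (simp add: cscale_cscale cscale_1)
  have "bounded_linear ?R" using bounded_linear_compose[OF S(1) bounded_linear_cscale] .
  moreover have "?R (cscale z p - complexify T p) = p" for p
    using S(2)[of p] z by (simp add: cs.diff inv U_def)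
  moreover have "cscale z (?R p) - complexify T (?R p) = p" for p
  proof -
    have "cscale z (?R p) - complexify T (?R p) = cscale z (?R p - U (?R p))"
      using z by (simp add: cs.diff inv U_def)
    then show ?thesis using z by (simp only: S(3)) (simp add: inv)
  qed
  ultimately show ?thesis unfolding spectrum_def by blast
qed

text \<open>A resolvent bounded by \<open>K\<close>, tested on the pairs \<open>(x, 0)\<close>,
  would give |x| \<le> K |r x - T x| for all x. An approximate eigenvector with error
  \<open>1 / (2 * K)\<close> violates this.\<close>

lemma approximate_eigenvalue_in_spectrum:
  fixes T :: "'e::real_normed_vector \<Rightarrow> 'e"
  assumes "T 0 = 0"
    and approx: "\<And>e. 0 < e \<Longrightarrow> \<exists>x. x \<noteq> 0 \<and> norm (r *\<^sub>R x - T x) \<le> e * norm x"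
  shows "complex_of_real r \<in> spectrum T"
proof (rule ccontr)
  assume "complex_of_real r \<notin> spectrum T"
  then obtain S where S: "bounded_linear S"
    and inv: "\<And>p. S (cscale (complex_of_real r) p - complexify T p) = p"
    unfolding spectrum_def by blast
  from bounded_linear.pos_bounded[OF S] obtain K where K: "0 < K" "\<And>p. norm (S p) \<le> norm p * K"
    by blast
  obtain x where x: "x \<noteq> 0" "norm (r *\<^sub>R x - T x) \<le> 1 / (2 * K) * norm x"
    using approx[of "1 / (2 * K)"] K(1) by auto
  have "S (r *\<^sub>R x - T x, 0) = (x, 0)"
    using inv[of "(x, 0)"] assms(1) by (simp add: cscale_def complexify_def)
  then have "norm x \<le> norm (r *\<^sub>R x - T x) * K"
    using K(2)[of "(r *\<^sub>R x - T x, 0)"] by simp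
  also have "\<dots> \<le> 1 / (2 * K) * norm x * K"
    using x(2) K(1) by (intro mult_right_mono) auto
  also have "\<dots> = norm x / 2" using K(1) by simp
  finally show False using x(1) by simp
qed

section \<open>Growth of substituted words\<close>

text \<open>Serves to absorb multiplicative constants by slightly widening the base of a
  power.\<close>

lemma eventually_power_le:
  fixes p q D :: real
  assumes "0 \<le> p" "p < q" "0 < D"
  shows "\<exists>N. \<forall>n\<ge>N. p ^ n \<le> D * q ^ n"
proof -
  have "(\<lambda>n. (p / q) ^ n) \<longlonglongrightarrow> 0"
    using assms by (intro LIMSEQ_power_zero) auto
  from order_tendstoD(2)[OF this \<open>0 < D\<close>] obtain N where "\<And>n. n \<ge> N \<Longrightarrow> (p / q) ^ n < D"
    by (auto simp: eventually_sequentially)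
  moreover have "p ^ n \<le> D * q ^ n" if "(p / q) ^ n < D" for n
    using that assms by (simp add: power_divide divide_less_eq split: if_splits)
  ultimately show ?thesis by blast
qed

locale irreducible_substitution =
  fixes \<rho> :: "'a::t2_space \<Rightarrow> 'a list"
  assumes compact_alphabet: "compact (UNIV :: 'a set)"
    and subst: "substitution \<rho>"
    and long: "generates_long_words \<rho>"
    and irred: "irreducible_subst \<rho>"
begin

abbreviation M :: "('a \<Rightarrow>\<^sub>C real) \<Rightarrow> ('a \<Rightarrow>\<^sub>C real)" where
  "M \<equiv> subst_operator \<rho>"

abbreviation len :: "nat \<Rightarrow> 'a \<Rightarrow> nat" where
  "len n a \<equiv> length (subst_iter \<rho> n a)"

lemma M_power: "apply_bcontfun ((M ^^ n) f) a = (\<Sum>b\<leftarrow>subst_iter \<rho> n a. f b)"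
proof (induction n arbitrary: f)
  case (Suc n)
  have "apply_bcontfun ((M ^^ Suc n) f) a = (\<Sum>b\<leftarrow>subst_iter \<rho> n a. M f b)"
    by (simp only: funpow_Suc_right o_def Suc)
  also have "\<dots> = (\<Sum>b\<leftarrow>subst_iter \<rho> (Suc n) a. f b)"
    by (simp add: apply_subst_operator[OF compact_alphabet subst] sum_list_subst_word subst_iter_Suc)
  finally show ?case .
qed simp

lemma M_power_one: "apply_bcontfun ((M ^^ n) (const_bcontfun 1)) a = len n a"
  by (simp add: M_power sum_list_triv)

lemma continuous_len: "continuous_on S (\<lambda>a. real (len n a))"
  using continuous_on_apply_bcontfun[of S "(M ^^ n) (const_bcontfun 1)"] by (simp add: M_power_one)

lemma len_1: "len 1 a = length (\<rho> a)"
  by (simp add: subst_iter_Suc subst_word_def)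

lemma bounded_length: obtains B where "1 \<le> B" "\<And>a. real (length (\<rho> a)) \<le> B"
proof
  fix a
  let ?h = "(M ^^ 1) (const_bcontfun 1)"
  show "real (length (\<rho> a)) \<le> max 1 (norm ?h)"
    using norm_bounded[of ?h a] by (simp only: M_power_one len_1) simp
qed simp

section \<open>Irreducibility and uniform growth of lengths\<close>

lemma invariant_eq_UNIV:
  assumes "B \<noteq> {}" "closed B" "\<rho> ` B \<subseteq> lists B"
  shows "B = UNIV"
  using irred[unfolded irreducible_subst_def, simplified not_ex, rule_format, of B] assms
  by (simp add: psubset_eq)

text \<open>If \<open>\<rho> a\<close> is empty, the closed set \<open>{a}\<close> is invariant and
  hence is the whole alphabet. Then no iterate has length above 1, against the standing
  assumption.\<close>

lemma rho_nonempty: "\<rho> a \<noteq> []"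
proof
  assume a: "\<rho> a = []"
  then have "{a} = UNIV" by (intro invariant_eq_UNIV) auto
  then have "\<rho> b = []" for b using a UNIV_I[of b] by (simp flip: \<open>{a} = UNIV\<close>)
  then have "len n b \<le> 1" for n b
    by (cases n) (simp_all add: subst_iter_Suc_left)
  then show False
    using long[unfolded generates_long_words_def, rule_format, of "Suc 1"] by (meson not_less_eq_eq)
qed

lemma len_Suc: "len (Suc n) a = (\<Sum>b\<leftarrow>subst_iter \<rho> n a. length (\<rho> b))"
  by (simp add: subst_iter_Suc length_subst_word)

lemma length_le_subst_word: "length u \<le> length (subst_word \<rho> u)"
proof (induction u)
  case (Cons b u)
  moreover have "1 \<le> length (\<rho> b)" using rho_nonempty[of b] by (cases "\<rho> b") auto
  ultimately show ?case by (simp add: subst_word_def del: One_nat_def)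
qed simp

lemma len_mono: "m \<le> n \<Longrightarrow> len m a \<le> len n a"
  by (rule lift_Suc_mono_le[of "\<lambda>n. len n a"]) (simp_all add: subst_iter_Suc length_le_subst_word)

lemma len_ge_1: "1 \<le> len n a"
  using len_mono[of 0 n a] by simp

lemma len_le_len_Suc:
  assumes "b \<in> set (\<rho> a)" shows "len n b \<le> len (Suc n) a"
proof -
  have "len n b \<in> set (map (len n) (\<rho> a))" using assms by auto
  from member_le_sum_list[OF this] show ?thesis
    by (simp add: subst_iter_Suc_left length_concat o_def)
qed

lemma closed_len_le: "closed {a. len n a \<le> K}"
  using closed_Collect_le[OF continuous_len continuous_on_const, of n "real K"] by simp

text \<open>The letters whose iterates all have length at most \<open>K\<close> form a closed set.
  It is invariant by \<open>len_le_len_Suc\<close>, so if nonempty it is the whole alphabet,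
  contradicting the generation of long words.\<close>

lemma len_unbounded: "\<exists>n. K < len n a"
proof (rule ccontr)
  let ?B = "\<Inter>n. {a. len n a \<le> K}"
  assume "\<nexists>n. K < len n a"
  then have "?B \<noteq> {}" by (auto simp: not_less)
  moreover have "closed ?B" using closed_len_le by blast
  moreover have "\<rho> ` ?B \<subseteq> lists ?B"
    using len_le_len_Suc by (fastforce intro: order_trans)
  ultimately have "?B = UNIV"
    by (rule invariant_eq_UNIV)
  then have "len n b \<le> K" for n b by blast
  then show False
    using long[unfolded generates_long_words_def, rule_format, of "Suc K"] by (meson not_less_eq_eq)
qed

text \<open>By compactness finitely many exponents serve all letters, and since lengths are
  nondecreasing in \<open>n\<close> the largest of them works for every letter.\<close>

lemma len_uniformly_unbounded: "\<exists>n0. \<forall>n\<ge>n0. \<forall>a. K < len n a"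
proof -
  have "UNIV \<inter> (\<Inter>n. {a. len n a \<le> K}) = {}"
    using len_unbounded[of K] by (fastforce simp flip: not_le)
  then obtain I where I: "finite I" "(\<Inter>n\<in>I. {a. len n a \<le> K}) = {}"
    using compact_imp_fip_image[OF compact_alphabet, of UNIV "\<lambda>n. {a. len n a \<le> K}"] closed_len_le
    by auto
  have "K < len n a" if "n \<ge> Max (insert 0 I)" for n a
  proof -
    have "a \<notin> (\<Inter>n\<in>I. {a. len n a \<le> K})" by (simp add: I(2))
    then obtain i where "i \<in> I" "K < len i a" by (auto simp: not_le)
    moreover have "i \<le> n" using that I(1) \<open>i \<in> I\<close> by auto
    ultimately show ?thesis using len_mono[of i n a] by linarith
  qed
  then show ?thesis by blast
qed

text \<open>Uniform averages over blocks of a fixed length \<open>m\<close> persist on an open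
  neighbourhood of the subshift. Every block of a long iterate away from its ends falls into this
  neighbourhood, and the ends contribute a bounded error.\<close>

lemma len_ratio:
  assumes "uniquely_ergodic (subshift \<rho>)"
  obtains r :: real where
    "\<And>e::real. 0 < e \<Longrightarrow> \<exists>n0. \<forall>n\<ge>n0. \<forall>a. \<bar>real (len (Suc n) a) - r * len n a\<bar> \<le> e * len n a"
proof -
  let ?X = "subshift \<rho>" and ?l = "\<lambda>b. real (length (\<rho> b))"
  obtain \<nu> where \<nu>: "\<And>\<mu>. probability_on ?X \<mu> \<Longrightarrow> invariant_on ?X left_shift \<mu> \<Longrightarrow> \<mu> = \<nu>"
    using assms unfolding uniquely_ergodic_def by blast
  obtain B where B: "1 \<le> B" "\<And>a. ?l a \<le> B" by (rule bounded_length) blast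
  have cont_l: "continuous_on UNIV ?l"
    using continuous_len[of UNIV 1] by (simp only: len_1)
  have cont_lw: "continuous_on S (\<lambda>w :: int \<Rightarrow> 'a. ?l (w i))" for S i
    using continuous_on_compose2[OF cont_l continuous_on_product_coordinates[of i]] continuous_on_subset
    by blast
  define f where "f = (\<lambda>w\<in>?X. ?l (w 0))"
  have f: "f \<in> C_space ?X"
    unfolding C_space_iff f_def using B(2) cont_lw
    by (auto simp: bounded_iff cong: continuous_on_cong)
  define r where "r = \<nu> f"
  show thesis
  proof (rule that[of r])
    fix e :: real assume "0 < e"
    then obtain m where m: "0 < m"
      and avg: "\<And>w. w \<in> ?X \<Longrightarrow> \<bar>(\<Sum>i<m. f ((left_shift ^^ i) w)) - m * \<nu> f\<bar> < e / 2 * m"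
      using birkhoff_average_uniform[OF continuous_left_shift left_shift_subshift \<nu> f, of "e / 2"]
      by auto
    \<comment> \<open>Defined on all bi-infinite sequences through finitely many coordinates, so
      that it is open and can be tested on extensions of finite words.\<close>
    define U where "U = {w :: int \<Rightarrow> 'a. \<bar>(\<Sum>i<m. ?l (w (int i))) - m * r\<bar> < e / 2 * m}"
    have "open U" unfolding U_def
      by (intro open_Collect_less continuous_intros cont_lw)
    moreover have "?X \<subseteq> U"
    proof
      fix w assume w: "w \<in> ?X"
      then have "(left_shift ^^ i) w \<in> ?X" for i
        using left_shift_subshift by (induction i) auto
      then show "w \<in> U"
        using avg[OF w] by (simp add: U_def r_def f_def left_shift_power)
    qed
    ultimately obtain N where N: "central_subshift \<rho> N \<subseteq> U"
      using central_subshift_subset_open[OF compact_alphabet] by blast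
    define K where "K = B + \<bar>r\<bar>"
    \<comment> \<open>The threshold makes \<open>(m + 2 * N) * K\<close> at most half of
      \<open>e * L\<close>: this pays for the leftover block and the two ends, while the other half
      of \<open>e\<close> is spent on the full blocks.\<close>
    obtain n0 where n0: "\<And>n a. n \<ge> n0 \<Longrightarrow> nat \<lceil>2 * (m + 2 * N) * K / e\<rceil> + 2 * N < len n a"
      using len_uniformly_unbounded by meson
    have "\<bar>real (len (Suc n) a) - r * len n a\<bar> \<le> e * len n a" if "n \<ge> n0" for n a
    proof -
      define u where "u = subst_iter \<rho> n a"
      define L where "L = length u"
      \<comment> \<open>An arbitrary bi-infinite extension of \<open>u\<close>; only its values at
        positions 0 to \<open>L - 1\<close> matter.\<close>
      define w where "w i = u ! nat i" for i :: int
      define x where "x i = ?l (u ! i) - r" for i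
      have L: "2 * (m + 2 * N) * K / e \<le> L" "2 * N \<le> L"
        using n0[OF that, of a] unfolding L_def u_def by linarith+
      \<comment> \<open>This holds even for indices beyond the end of \<open>u\<close>, since
        \<open>B\<close> bounds the image length of every letter.\<close>
      have x_le: "\<bar>x i\<bar> \<le> K" for i
        unfolding x_def K_def using B(2)[of "u ! i"] by linarith
      have "0 \<le> K" using x_le[of 0] by linarith
      have "(left_shift ^^ j) w \<in> U" if "N \<le> j" "j + N \<le> L" for j
        using subst_iter_in_central_subshift[OF u_def, of w N j] that N by (auto simp: w_def L_def)
      then have block: "\<bar>\<Sum>i<m. x (j + i)\<bar> \<le> e / 2 * m" if "N \<le> j" "j + m \<le> L - N" for j
        using that L(2) \<open>0 < m\<close>
        by (fastforce simp: U_def left_shift_power w_def x_def sum_subtractf nat_add_distrib add.commute)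
      have "\<bar>\<Sum>i<L - 2 * N. x (N + i)\<bar> \<le> e / 2 * (L - 2 * N) + m * K"
        using \<open>0 < e\<close> L(2) \<open>0 \<le> K\<close> by (intro abs_sum_blocks_le[OF m block]) (auto simp: x_le)
      also have "\<dots> \<le> e / 2 * L + m * K"
        using \<open>0 < e\<close> by (intro add_mono mult_left_mono) auto
      finally have middle: "\<bar>\<Sum>i<L - 2 * N. x (N + i)\<bar> \<le> e / 2 * L + m * K" .
      have ends: "\<bar>\<Sum>i<N. x (s + i)\<bar> \<le> N * K" for s
        using order_trans[OF sum_abs sum_mono[of "{..<N}" "\<lambda>i. \<bar>x (s + i)\<bar>" "\<lambda>_. K"]] x_le by simp
      have "real (len (Suc n) a) - r * L = (\<Sum>i<L. x i)"
        by (simp add: len_Suc x_def sum_subtractf sum_list_sum_nth atLeast0LessThan flip: u_def L_def)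
      \<comment> \<open>The two ends of length \<open>N\<close> are split off, leaving the part on
        which \<open>block\<close> applies.\<close>
      also have "\<dots> = (\<Sum>i<N. x (0 + i)) + (\<Sum>i<L - 2 * N. x (N + i)) + (\<Sum>i<N. x (L - N + i))"
        using sum_lessThan_add[of x "L - N" N] sum_lessThan_add[of x N "L - 2 * N"] L(2) by simp
      also have "\<bar>\<dots>\<bar> \<le> e / 2 * L + (m + 2 * N) * K"
        using middle ends[of 0] ends[of "L - N"] unfolding abs_le_iff
        by (simp add: algebra_simps)
      also have "\<dots> \<le> e * L"
        using L(1) \<open>0 < e\<close> by (simp add: field_simps)
      finally show ?thesis by (simp add: L_def u_def)
    qed
    then show "\<exists>n0. \<forall>n\<ge>n0. \<forall>a. \<bar>real (len (Suc n) a) - r * len n a\<bar> \<le> e * len n a" by blast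
  qed
qed

lemma norm_M_power_le:
  assumes "\<And>a. real (len n a) \<le> K" shows "norm ((M ^^ n) f) \<le> K * norm f"
proof (rule norm_bound)
  fix a
  have abs_sum: "\<bar>\<Sum>b\<leftarrow>u. apply_bcontfun f b\<bar> \<le> real (length u) * norm f" for u
  proof (induction u)
    case (Cons b u)
    then show ?case using norm_bounded[of f b] by (simp add: algebra_simps)
  qed simp
  have "real (len n a) * norm f \<le> K * norm f" using assms[of a] by (simp add: mult_right_mono)
  with abs_sum[of "subst_iter \<rho> n a"] show "norm (apply_bcontfun ((M ^^ n) f) a) \<le> K * norm f"
    by (simp add: M_power)
qed

lemma bounded_linear_M: "bounded_linear M"
proof -
  obtain B where "\<And>a. real (length (\<rho> a)) \<le> B" by (rule bounded_length) blast
  then have "norm (M f) \<le> norm f * B" for f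
    using norm_M_power_le[of 1 B f] unfolding len_1 by (simp add: mult.commute)
  then show ?thesis
    by (intro bounded_linear_intro bcontfun_eqI)
      (auto simp: apply_subst_operator[OF compact_alphabet subst] sum_list_addf sum_list_const_mult)
qed

section \<open>Exponential bounds and the spectral radius from the limiting ratio\<close>

context
  fixes r :: real
  assumes ratio: "\<And>e::real. 0 < e \<Longrightarrow>
    \<exists>n0. \<forall>n\<ge>n0. \<forall>a. \<bar>real (len (Suc n) a) - r * len n a\<bar> \<le> e * len n a"
begin

text \<open>Lengths are positive and never decrease, so their asymptotic quotient cannot lie below
  1.\<close>

lemma ratio_ge_1: "1 \<le> r"
proof (rule field_le_epsilon)
  fix e :: real assume "0 < e"
  then obtain n where n: "\<And>a. \<bar>real (len (Suc n) a) - r * len n a\<bar> \<le> e * len n a"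
    using ratio by blast
  have "real (len n a) \<le> (r + e) * len n a" for a
    using n[of a] len_mono[of n "Suc n" a] by (simp add: algebra_simps)
  then have "1 * real (len n a) \<le> (r + e) * len n a" for a by simp
  then show "1 \<le> r + e" using len_ge_1[of n] mult_right_le_imp_le by (metis of_nat_0_less_iff less_le_trans zero_less_one)
qed

text \<open>From some \<open>n0\<close> on each step multiplies the length by at most
  \<open>c\<close>; the finitely many earlier exponents are absorbed into \<open>C\<close>.\<close>

lemma len_upper:
  fixes c :: real
  assumes "r < c"
  shows "\<exists>C>0. \<forall>n a. len n a \<le> C * c ^ n"
proof -
  have "0 < c" using assms ratio_ge_1 by linarith
  obtain n0 where n0: "\<And>n a. n \<ge> n0 \<Longrightarrow> \<bar>real (len (Suc n) a) - r * len n a\<bar> \<le> (c - r) * len n a"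
    using ratio[of "c - r"] assms by auto
  \<comment> \<open>\<open>h j\<close> is the least constant that works at exponent \<open>j\<close>
    for all letters, because the norm is the supremum of \<open>len j\<close>. Adding 1 to the sum
    of these keeps \<open>C\<close> positive.\<close>
  define h where "h j = norm ((M ^^ j) (const_bcontfun 1)) / c ^ j" for j
  define C where "C = 1 + (\<Sum>j\<le>n0. h j)"
  have h: "0 \<le> h j" for j using \<open>0 < c\<close> by (simp add: h_def)
  have init: "len n a \<le> C * c ^ n" if "n \<le> n0" for n a
  proof -
    have "h n \<le> C"
      unfolding C_def using member_le_sum[of n "{..n0}" h] that h by force
    moreover have "len n a \<le> h n * c ^ n"
      using norm_bounded[of "(M ^^ n) (const_bcontfun 1)" a] \<open>0 < c\<close> by (simp add: M_power_one h_def)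
    ultimately show ?thesis
      using \<open>0 < c\<close> by (meson mult_right_mono order_trans zero_le_power less_imp_le)
  qed
  have "len (n0 + k) a \<le> C * c ^ (n0 + k)" for k a
  proof (induction k)
    case 0
    show ?case using init[of n0 a] by simp
  next
    case (Suc k)
    have "len (n0 + Suc k) a \<le> c * len (n0 + k) a"
      using n0[of "n0 + k" a] by (simp add: algebra_simps)
    also have "\<dots> \<le> c * (C * c ^ (n0 + k))"
      using Suc \<open>0 < c\<close> by (intro mult_left_mono) auto
    finally show ?case by (simp add: algebra_simps)
  qed
  with init have "len n a \<le> C * c ^ n" for n a
    by (metis le_add_diff_inverse nat_le_linear)
  moreover have "0 < C" unfolding C_def using h by (simp add: add_pos_nonneg sum_nonneg)
  ultimately show ?thesis by blast
qed

text \<open>From some \<open>n0\<close> on each step multiplies the length by at least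
  \<open>c\<close>, starting from a length of at least 1; the factor \<open>1 / c ^ n0\<close>
  accounts for the late start.\<close>

lemma len_lower:
  fixes c :: real
  assumes "0 < c" "c < r"
  shows "\<exists>n0. \<forall>n\<ge>n0. \<forall>a. 1 / c ^ n0 * c ^ n \<le> len n a"
proof -
  obtain n0 where n0: "\<And>n a. n \<ge> n0 \<Longrightarrow> \<bar>real (len (Suc n) a) - r * len n a\<bar> \<le> (r - c) * len n a"
    using ratio[of "r - c"] assms by auto
  have "c ^ k \<le> len (n0 + k) a" for k a
  proof (induction k)
    case 0
    show ?case using len_ge_1[of n0 a] by simp
  next
    case (Suc k)
    then have "c * c ^ k \<le> c * len (n0 + k) a"
      using \<open>0 < c\<close> by (intro mult_left_mono) auto
    also have "\<dots> \<le> len (n0 + Suc k) a"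
      using n0[of "n0 + k" a] by (simp add: algebra_simps)
    finally show ?case by simp
  qed
  then have "1 / c ^ n0 * c ^ n \<le> len n a" if "n0 \<le> n" for n a
    using that \<open>0 < c\<close> by (metis le_Suc_ex nonzero_mult_div_cancel_left power_add power_eq_0_iff less_irrefl times_divide_eq_left mult_1)
  then show ?thesis by blast
qed

lemma ratio_in_spectrum: "complex_of_real r \<in> spectrum M"
proof (rule approximate_eigenvalue_in_spectrum)
  show "M 0 = 0" by (rule linear_simps(3)[OF bounded_linear_M])
next
  fix e :: real assume "0 < e"
  then obtain n where n: "\<And>a. \<bar>real (len (Suc n) a) - r * len n a\<bar> \<le> e * len n a"
    using ratio by blast
  let ?h = "(M ^^ n) (const_bcontfun 1)"
  have "?h \<noteq> 0"
  proof
    assume "?h = 0"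
    then show False using M_power_one[of n undefined] len_ge_1[of n undefined] by simp
  qed
  moreover have "norm (r *\<^sub>R ?h - M ?h) \<le> e * norm ?h"
  proof (rule norm_bound)
    fix a
    have "apply_bcontfun (M ?h) a = len (Suc n) a" using M_power_one[of "Suc n" a] by simp
    then have "norm (apply_bcontfun (r *\<^sub>R ?h - M ?h) a) = \<bar>real (len (Suc n) a) - r * len n a\<bar>"
      by (simp add: M_power_one)
    also have "\<dots> \<le> e * len n a" by (rule n)
    \<comment> \<open>The error is relative to the length at each letter, hence also to the largest
      length, which is the norm of \<open>?h\<close>.\<close>
    also have "\<dots> \<le> e * norm ?h"
      using norm_bounded[of ?h a] \<open>0 < e\<close> by (intro mult_left_mono) (simp_all add: M_power_one)
    finally show "norm (apply_bcontfun (r *\<^sub>R ?h - M ?h) a) \<le> e * norm ?h" .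
  qed
  ultimately show "\<exists>x. x \<noteq> 0 \<and> norm (r *\<^sub>R x - M x) \<le> e * norm x" by blast
qed

text \<open>The value \<open>r\<close> is attained in the spectrum. For |z| > r, choose
  \<open>c\<close> strictly between: \<open>len_upper\<close> bounds the powers of \<open>M\<close>
  by \<open>C * c ^ n\<close>, which excludes \<open>z\<close>.\<close>

lemma spectral_radius_eq_ratio: "spectral_radius M = r"
  unfolding spectral_radius_def
proof (rule cSup_eq_maximum)
  show "r \<in> cmod ` spectrum M"
    using ratio_in_spectrum ratio_ge_1 by (intro image_eqI[of _ _ "complex_of_real r"]) auto
  fix t assume "t \<in> cmod ` spectrum M"
  then obtain z where z: "z \<in> spectrum M" "t = cmod z" by blast
  show "t \<le> r"
  proof (rule ccontr)
    assume "\<not> t \<le> r"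
    then obtain c :: real where c: "r < c" "c < cmod z" using dense z(2) by (metis not_le)
    obtain C :: real where C: "\<And>n a. len n a \<le> C * c ^ n" using len_upper[OF c(1)] by meson
    have "0 < c" using c(1) ratio_ge_1 by linarith
    from power_bounded_not_in_spectrum[OF summable_bcontfun bounded_linear_M
        norm_M_power_le[OF C] this c(2)]
    have "z \<notin> spectrum M" .
    with z(1) show False by contradiction
  qed
qed

end

end

theorem proposition3p6:
  fixes \<rho> :: "'a::t2_space \<Rightarrow> 'a list"
  assumes "compact (UNIV :: 'a set)"
    and "substitution \<rho>"
    and "generates_long_words \<rho>"
    and "irreducible_subst \<rho>"
    and "uniquely_ergodic (subshift \<rho>)"
  shows "\<forall>\<epsilon>. 0 < \<epsilon> \<and> \<epsilon> < spectral_radius (subst_operator \<rho>) \<longrightarrow>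
    (\<exists>N. \<forall>a. \<forall>n\<ge>N.
       (spectral_radius (subst_operator \<rho>) - \<epsilon>) ^ n \<le> real (length (subst_iter \<rho> n a)) \<and>
       real (length (subst_iter \<rho> n a)) \<le> (spectral_radius (subst_operator \<rho>) + \<epsilon>) ^ n)"
proof -
  interpret irreducible_substitution \<rho>
    using assms(1-4) by unfold_locales
  obtain r :: real where ratio: "\<And>e::real. 0 < e \<Longrightarrow>
      \<exists>n0. \<forall>n\<ge>n0. \<forall>a. \<bar>real (len (Suc n) a) - r * len n a\<bar> \<le> e * len n a"
    using len_ratio[OF assms(5)] by blast
  have r: "spectral_radius M = r" by (rule spectral_radius_eq_ratio[OF ratio])
  have "\<exists>N. \<forall>a. \<forall>n\<ge>N. (r - \<epsilon>) ^ n \<le> len n a \<and> len n a \<le> (r + \<epsilon>) ^ n"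
    if \<epsilon>: "0 < \<epsilon>" "\<epsilon> < r" for \<epsilon> :: real
  proof -
    \<comment> \<open>Both bounds are first taken at half the distance, with bases
      \<open>r + \<epsilon> / 2\<close> and \<open>r - \<epsilon> / 2\<close>. The remaining gap
      lets \<open>eventually_power_le\<close> remove the constants \<open>C\<close> and
      \<open>1 / (r - \<epsilon> / 2) ^ n0\<close>.\<close>
    obtain C :: real where C: "0 < C" "\<And>n a. len n a \<le> C * (r + \<epsilon> / 2) ^ n"
      using len_upper[OF ratio, of "r + \<epsilon> / 2"] \<epsilon> by (meson half_gt_zero less_add_same_cancel1)
    have "0 < r - \<epsilon> / 2" "r - \<epsilon> / 2 < r" using \<epsilon> by auto
    from len_lower[OF ratio this] obtain n0 where n0: "\<And>n a. n0 \<le> n \<Longrightarrow> 1 / (r - \<epsilon> / 2) ^ n0 * (r - \<epsilon> / 2) ^ n \<le> len n a"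
      by meson
    obtain N1 where N1: "\<And>n. n \<ge> N1 \<Longrightarrow> (r + \<epsilon> / 2) ^ n \<le> 1 / C * (r + \<epsilon>) ^ n"
      using eventually_power_le[of "r + \<epsilon> / 2" "r + \<epsilon>" "1 / C"] \<epsilon> C(1) by auto
    obtain N2 where N2: "\<And>n. n \<ge> N2 \<Longrightarrow> (r - \<epsilon>) ^ n \<le> 1 / (r - \<epsilon> / 2) ^ n0 * (r - \<epsilon> / 2) ^ n"
      using eventually_power_le[of "r - \<epsilon>" "r - \<epsilon> / 2" "1 / (r - \<epsilon> / 2) ^ n0"] \<epsilon> by auto
    have "(r - \<epsilon>) ^ n \<le> len n a \<and> len n a \<le> (r + \<epsilon>) ^ n" if "n \<ge> max n0 (max N1 N2)" for n a
    proof
      show "(r - \<epsilon>) ^ n \<le> len n a" using N2[of n] n0[of n a] that by linarith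
      have "C * (r + \<epsilon> / 2) ^ n \<le> (r + \<epsilon>) ^ n" using N1[of n] that C(1) by (simp add: field_simps)
      then show "len n a \<le> (r + \<epsilon>) ^ n" using C(2)[of n a] by linarith
    qed
    then show ?thesis by blast
  qed
  then show ?thesis unfolding r by blast
qed

end
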